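(* Fix $r\in\mathbb{N}$ and let $\mathcal{A}$ and $\mathcal{B}$ be two sets of finite $\tau$-structures. The following are equivalent: (a) Duplicator wins the $r$-round MS game on $(\mathcal{A},\mathcal{B})$; (b) Duplicator wins the $r$-round MS game without duplicating on $(\mathcal{A}^+,\mathcal{B}^+)$, where $\mathcal{A}^+$ is the multiset consisting of $|A|^r$ copies of each $\mathbf{A}\in\mathcal{A}$ (with $A$ the universe of $\mathbf{A}$) and $\mathcal{B}^+$ is the multiset consisting of $|B|^r$ copies of each $\mathbf{B}\in\mathcal{B}$.
   Context: Fix a schema $\tau$ with finitely many relation and constant symbols. A pebbled structure $\langle \mathbf{A} \mid a_1,\dots,a_t\rangle$ is a $\tau$-structure with elements $a_1,\dots,a_t$ (not necessarily distinct), $a_i$ carrying pebble color $i$. Two pebbled structures $\langle \mathbf{A}\mid a_1,\dots,a_t\rangle$, $\langle \mathbf{B}\mid b_1,\dots,b_t\rangle$ form a matching pair if the map $a_i\mapsto b_i$, $c^{\mathbf{A}}\mapsto c^{\mathbf{B}}$ (for constant symbols $c$) is an isomorphism between the substructures induced by its domain and range. The $r$-round MS game on $(\mathcal{A},\mathcal{B})$: start at $(\mathcal{A}_0,\mathcal{B}_0)=(\mathcal{A},\mathcal{B})$; if no left/right matching pair exists, Spoiler wins. In round $t=1,\dots,r$ Spoiler chooses a side, say left (right is symmetric), and places pebble $t$ on an element of each pebbled structure in $\mathcal{A}_{t-1}$, giving $\mathcal{A}_t$; Duplicator, for each pebbled structure in $\mathcal{B}_{t-1}$, may make any number of copies and places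 pebble $t$ on an element of each copy, giving $\mathcal{B}_t$. If no member of $\mathcal{A}_t$ forms a matching pair with a member of $\mathcal{B}_t$, Spoiler wins. Duplicator wins if a matching pair remains after round $r$. The game "without duplicating" on multisets is the same game except that Duplicator may not make copies: she places exactly one pebble on each (copy of a) pebbled structure on her side. "Wins" means has a winning strategy. *)

theory Defs
  imports Main
begin

record ('r, 'c) schema =
  rel_syms :: "'r set"
  const_syms :: "'c set"
  arity :: "'r \<Rightarrow> nat"

definition finite_schema :: "('r, 'c) schema \<Rightarrow> bool" where
  "finite_schema \<tau> \<longleftrightarrow> finite (rel_syms \<tau>) \<and> finite (const_syms \<tau>)"

record ('r, 'c, 'a) struct =
  univ :: "'a set"
  rel :: "'r \<Rightarrow> 'a list set"
  con :: "'c \<Rightarrow> 'a"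

text \<open>The interpretation of symbols outside the schema is fixed to a dummy value, so that two
  structures are equal iff they agree on their universe and on the symbols of the schema.\<close>

definition is_structure :: "('r, 'c) schema \<Rightarrow> ('r, 'c, 'a) struct \<Rightarrow> bool" where
  "is_structure \<tau> A \<longleftrightarrow>
     univ A \<noteq> {} \<and>
     (\<forall>R\<in>rel_syms \<tau>. rel A R \<subseteq> {xs. set xs \<subseteq> univ A \<and> length xs = arity \<tau> R}) \<and>
     (\<forall>c\<in>const_syms \<tau>. con A c \<in> univ A) \<and>
     (\<forall>R. R \<notin> rel_syms \<tau> \<longrightarrow> rel A R = {}) \<and>
     (\<forall>c. c \<notin> const_syms \<tau> \<longrightarrow> con A c = undefined)"

definition finite_structure :: "('r, 'c) schema \<Rightarrow> ('r, 'c, 'a) struct \<Rightarrow> bool" where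
  "finite_structure \<tau> A \<longleftrightarrow> is_structure \<tau> A \<and> finite (univ A)"

definition induced :: "('r, 'c, 'a) struct \<Rightarrow> 'a set \<Rightarrow> ('r, 'c, 'a) struct" where
  "induced A D = \<lparr>univ = D, rel = (\<lambda>R. {xs \<in> rel A R. set xs \<subseteq> D}), con = con A\<rparr>"

definition isomorphism ::
  "('r, 'c) schema \<Rightarrow> ('a \<Rightarrow> 'b) \<Rightarrow> ('r, 'c, 'a) struct \<Rightarrow> ('r, 'c, 'b) struct \<Rightarrow> bool" where
  "isomorphism \<tau> h A B \<longleftrightarrow>
     bij_betw h (univ A) (univ B) \<and>
     (\<forall>R\<in>rel_syms \<tau>. \<forall>xs. set xs \<subseteq> univ A \<and> length xs = arity \<tau> R \<longrightarrow>
        (xs \<in> rel A R \<longleftrightarrow> map h xs \<in> rel B R)) \<and>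
     (\<forall>c\<in>const_syms \<tau>. h (con A c) = con B c)"

text \<open>In \<open>(A, as)\<close> pebble \<open>i\<close> (counted from 1) lies on the element \<open>as ! (i - 1)\<close>.\<close>

type_synonym ('r, 'c, 'a) pebbled = "('r, 'c, 'a) struct \<times> 'a list"

definition place :: "'a \<Rightarrow> ('r, 'c, 'a) pebbled \<Rightarrow> ('r, 'c, 'a) pebbled" where
  "place a p = (fst p, snd p @ [a])"

definition matching_pair ::
  "('r, 'c) schema \<Rightarrow> ('r, 'c, 'a) pebbled \<Rightarrow> ('r, 'c, 'a) pebbled \<Rightarrow> bool" where
  "matching_pair \<tau> p q \<longleftrightarrow>
     (case (p, q) of ((A, as), (B, bs)) \<Rightarrow>
        \<exists>h. map h as = bs \<and> (\<forall>c\<in>const_syms \<tau>. h (con A c) = con B c) \<and>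
            isomorphism \<tau> h
              (induced A (set as \<union> con A ` const_syms \<tau>))
              (induced B (set bs \<union> con B ` const_syms \<tau>)))"

definition matching_exists ::
  "('r, 'c) schema \<Rightarrow> ('r, 'c, 'a) pebbled set \<times> ('r, 'c, 'a) pebbled set \<Rightarrow> bool" where
  "matching_exists \<tau> pos \<longleftrightarrow> (\<exists>p\<in>fst pos. \<exists>q\<in>snd pos. matching_pair \<tau> p q)"

text \<open>An \<open>r\<close>-round game in which each round consists of a Spoiler step \<open>S\<close> from a position to an
  intermediate position followed by a Duplicator step \<open>D\<close> to the next position; Spoiler wins as
  soon as a position violates \<open>alive\<close>. A Duplicator strategy \<open>\<sigma>\<close> maps the list of intermediate
  positions so far (Spoiler's moves) to the next position. It is winning if, whenever the first
  \<open>n \<le> r\<close> rounds are played according to it against legal Spoiler moves \<open>Q\<close>, its own moves were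
  legal and the position reached is alive.\<close>

definition duplicator_wins ::
  "('p \<Rightarrow> 'q \<Rightarrow> bool) \<Rightarrow> ('q \<Rightarrow> 'p \<Rightarrow> bool) \<Rightarrow> ('p \<Rightarrow> bool) \<Rightarrow> nat \<Rightarrow> 'p \<Rightarrow> bool" where
  "duplicator_wins S D alive r p0 \<longleftrightarrow>
     (\<exists>\<sigma> :: 'q list \<Rightarrow> 'p. \<forall>n\<le>r. \<forall>P Q.
        P 0 = p0 \<and> (\<forall>t<n. S (P t) (Q t) \<and> P (Suc t) = \<sigma> (map Q [0..<Suc t])) \<longrightarrow>
        (\<forall>t<n. D (Q t) (P (Suc t))) \<and> alive (P n))"

datatype side = Left | Right

fun spoiler_step ::
  "('x \<Rightarrow> 'x \<Rightarrow> bool) \<Rightarrow> 'x \<times> 'x \<Rightarrow> side \<times> 'x \<times> 'x \<Rightarrow> bool" where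
  "spoiler_step move (X, Y) (Left, X', Y') \<longleftrightarrow> move X X' \<and> Y' = Y"
| "spoiler_step move (X, Y) (Right, X', Y') \<longleftrightarrow> X' = X \<and> move Y Y'"

fun duplicator_step ::
  "('x \<Rightarrow> 'x \<Rightarrow> bool) \<Rightarrow> side \<times> 'x \<times> 'x \<Rightarrow> 'x \<times> 'x \<Rightarrow> bool" where
  "duplicator_step move (Left, X, Y) (X', Y') \<longleftrightarrow> X' = X \<and> move Y Y'"
| "duplicator_step move (Right, X, Y) (X', Y') \<longleftrightarrow> move X X' \<and> Y' = Y"

definition place_each ::
  "('r, 'c, 'a) pebbled set \<Rightarrow> ('r, 'c, 'a) pebbled set \<Rightarrow> bool" where
  "place_each X X' \<longleftrightarrow>
     (\<exists>f. (\<forall>p\<in>X. f p \<in> univ (fst p)) \<and> X' = (\<lambda>p. place (f p) p) ` X)"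

text \<open>\<open>G p\<close> is the set of elements on which the new pebble is placed in \<open>p\<close> and its copies.\<close>

definition copy_and_place ::
  "('r, 'c, 'a) pebbled set \<Rightarrow> ('r, 'c, 'a) pebbled set \<Rightarrow> bool" where
  "copy_and_place X X' \<longleftrightarrow>
     (\<exists>G. (\<forall>p\<in>X. G p \<noteq> {} \<and> G p \<subseteq> univ (fst p)) \<and>
          X' = {place a p | p a. p \<in> X \<and> a \<in> G p})"

definition duplicator_wins_MS ::
  "('r, 'c) schema \<Rightarrow> nat \<Rightarrow> ('r, 'c, 'a) struct set \<Rightarrow> ('r, 'c, 'a) struct set \<Rightarrow> bool" where
  "duplicator_wins_MS \<tau> r \<A> \<B> \<longleftrightarrow>
     duplicator_wins (spoiler_step place_each) (duplicator_step copy_and_place)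
       (matching_exists \<tau>) r ((\<lambda>A. (A, [])) ` \<A>, (\<lambda>B. (B, [])) ` \<B>)"

text \<open>A multiset is represented by a set of pairs \<open>(x, k)\<close>, the tag \<open>k\<close> telling apart the copies
  of \<open>x\<close>; unlike the type \<open>multiset\<close> this allows infinitely many different elements. Tags never
  change during the game, so distinct copies stay distinct.\<close>

definition place_each_copy ::
  "(('r, 'c, 'a) pebbled \<times> nat) set \<Rightarrow> (('r, 'c, 'a) pebbled \<times> nat) set \<Rightarrow> bool" where
  "place_each_copy M M' \<longleftrightarrow>
     (\<exists>f. (\<forall>(p, k)\<in>M. f (p, k) \<in> univ (fst p)) \<and>
          M' = (\<lambda>(p, k). (place (f (p, k)) p, k)) ` M)"

definition duplicator_wins_nodup ::
  "('r, 'c) schema \<Rightarrow> nat \<Rightarrow> (('r, 'c, 'a) struct \<times> nat) set \<Rightarrow>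
     (('r, 'c, 'a) struct \<times> nat) set \<Rightarrow> bool" where
  "duplicator_wins_nodup \<tau> r M N \<longleftrightarrow>
     duplicator_wins (spoiler_step place_each_copy) (duplicator_step place_each_copy)
       (\<lambda>(X, Y). matching_exists \<tau> (fst ` X, fst ` Y)) r
       ((\<lambda>(A, k). ((A, []), k)) ` M, (\<lambda>(B, k). ((B, []), k)) ` N)"

definition copies :: "nat \<Rightarrow> ('r, 'c, 'a) struct set \<Rightarrow> (('r, 'c, 'a) struct \<times> nat) set" where
  "copies r \<A> = {(A, k). A \<in> \<A> \<and> k < card (univ A) ^ r}"

end

theory Submission
  imports Defs
begin

text \<open>If Duplicator wins without duplicating, she wins the MS game by placing her pebble in all
  possible ways, while Spoiler's moves are repeated uniformly on all copies. Conversely, with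
  \<open>s\<close> rounds left the game on multisets simulates an MS position in which every pebbled structure
  over \<open>A\<close> is represented by at least \<open>|A| ^ s\<close> copies: when Spoiler moves, some element of \<open>A\<close> is
  chosen in at least a fraction \<open>1 / |A|\<close> of these copies, and this is read as Spoiler's MS move;
  when Duplicator moves, she distributes the copies evenly over the elements of \<open>A\<close>.\<close>

section \<open>Round-based games\<close>

definition consistent_play ::
  "('p \<Rightarrow> 'q \<Rightarrow> bool) \<Rightarrow> ('q list \<Rightarrow> 'p) \<Rightarrow> 'p \<Rightarrow> nat \<Rightarrow> (nat \<Rightarrow> 'p) \<Rightarrow> (nat \<Rightarrow> 'q) \<Rightarrow> bool" where
  "consistent_play S \<sigma> p n P Q \<longleftrightarrow>
     P 0 = p \<and> (\<forall>t<n. S (P t) (Q t) \<and> P (Suc t) = \<sigma> (map Q [0..<Suc t]))"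

definition winning_strategy ::
  "('p \<Rightarrow> 'q \<Rightarrow> bool) \<Rightarrow> ('q \<Rightarrow> 'p \<Rightarrow> bool) \<Rightarrow> ('p \<Rightarrow> bool) \<Rightarrow> nat \<Rightarrow> 'p \<Rightarrow> ('q list \<Rightarrow> 'p) \<Rightarrow> bool"
  where
  "winning_strategy S D alive r p \<sigma> \<longleftrightarrow>
     (\<forall>n\<le>r. \<forall>P Q. consistent_play S \<sigma> p n P Q \<longrightarrow>
        (\<forall>t<n. D (Q t) (P (Suc t))) \<and> alive (P n))"

lemma duplicator_wins_iff_winning_strategy:
  "duplicator_wins S D alive r p \<longleftrightarrow> (\<exists>\<sigma>. winning_strategy S D alive r p \<sigma>)"
  unfolding duplicator_wins_def winning_strategy_def consistent_play_def ..

lemma winning_strategyD: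
  assumes "winning_strategy S D alive r p \<sigma>" "n \<le> r" "consistent_play S \<sigma> p n P Q"
  shows "(\<forall>t<n. D (Q t) (P (Suc t))) \<and> alive (P n)"
  using assms unfolding winning_strategy_def by blast

lemma consistent_play_Suc:
  "consistent_play S \<sigma> p (Suc n) P Q \<longleftrightarrow>
     P 0 = p \<and> S p (Q 0) \<and>
     consistent_play S (\<lambda>qs. \<sigma> (Q 0 # qs)) (\<sigma> [Q 0]) n (\<lambda>t. P (Suc t)) (\<lambda>t. Q (Suc t))"
  unfolding consistent_play_def All_less_Suc2 map_upt_Suc by auto

text \<open>A strategy is never consulted on the empty list: Spoiler moves first.\<close>

lemma winning_strategy_cong:
  assumes "\<And>q qs. \<sigma> (q # qs) = \<rho> (q # qs)"
  shows "winning_strategy S D alive r p \<sigma> \<longleftrightarrow> winning_strategy S D alive r p \<rho>"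
  unfolding winning_strategy_def consistent_play_def map_upt_Suc assms ..

lemma winning_strategy_SucD:
  assumes "winning_strategy S D alive (Suc r) p \<sigma>" "S p q"
  shows "D q (\<sigma> [q])" "winning_strategy S D alive r (\<sigma> [q]) (\<lambda>qs. \<sigma> (q # qs))"
proof -
  have extended_play:
    "D q (P 0) \<and> (\<forall>t<n. D (Q t) (P (Suc t))) \<and> alive (P n)"
    if "n \<le> r" "consistent_play S (\<lambda>qs. \<sigma> (q # qs)) (\<sigma> [q]) n P Q" for n P Q
  proof -
    have "consistent_play S \<sigma> p (Suc n) (case_nat p P) (case_nat q Q)"
      using that(2) assms(2) by (simp add: consistent_play_Suc)
    from winning_strategyD[OF assms(1) _ this] that(1) show ?thesis
      unfolding All_less_Suc2 by simp
  qed
  show "winning_strategy S D alive r (\<sigma> [q]) (\<lambda>qs. \<sigma> (q # qs))"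
    unfolding winning_strategy_def using extended_play by blast
  show "D q (\<sigma> [q])"
    using extended_play[of 0 "\<lambda>_. \<sigma> [q]"] by (simp add: consistent_play_def)
qed

lemma winning_strategy_imp_alive:
  assumes "winning_strategy S D alive r p \<sigma>"
  shows "alive p"
  using winning_strategyD[OF assms, of 0 "\<lambda>_. p"] by (simp add: consistent_play_def)

lemma winning_strategy_SucI:
  assumes "alive p"
    and "\<And>q. S p q \<Longrightarrow> D q (\<sigma> [q]) \<and> winning_strategy S D alive r (\<sigma> [q]) (\<lambda>qs. \<sigma> (q # qs))"
  shows "winning_strategy S D alive (Suc r) p \<sigma>"
  unfolding winning_strategy_def
proof (intro allI impI)
  fix n P Q
  assume n: "n \<le> Suc r" and play: "consistent_play S \<sigma> p n P Q"
  show "(\<forall>t<n. D (Q t) (P (Suc t))) \<and> alive (P n)"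
  proof (cases n)
    case 0
    then show ?thesis
      using play assms(1) by (simp add: consistent_play_def)
  next
    case (Suc m)
    then have first_move: "S p (Q 0)"
      and tail: "consistent_play S (\<lambda>qs. \<sigma> (Q 0 # qs)) (\<sigma> [Q 0]) m
        (\<lambda>t. P (Suc t)) (\<lambda>t. Q (Suc t))"
      using play by (auto simp: consistent_play_Suc)
    have "(\<forall>t<m. D (Q (Suc t)) (P (Suc (Suc t)))) \<and> alive (P (Suc m))"
      using winning_strategyD[OF conjunct2[OF assms(2)[OF first_move]] _ tail] n Suc by simp
    moreover have "D (Q 0) (P (Suc 0))"
      using assms(2)[OF first_move] tail by (simp add: consistent_play_def)
    ultimately show ?thesis
      unfolding Suc All_less_Suc2 by blast
  qed
qed

lemma duplicator_wins_0: "duplicator_wins S D alive 0 p \<longleftrightarrow> alive p"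
  unfolding duplicator_wins_def by auto

lemma duplicator_wins_Suc:
  "duplicator_wins S D alive (Suc r) p \<longleftrightarrow>
     alive p \<and> (\<forall>q. S p q \<longrightarrow> (\<exists>p'. D q p' \<and> duplicator_wins S D alive r p'))"
proof
  assume "duplicator_wins S D alive (Suc r) p"
  then obtain \<sigma> where \<sigma>: "winning_strategy S D alive (Suc r) p \<sigma>"
    unfolding duplicator_wins_iff_winning_strategy ..
  show "alive p \<and> (\<forall>q. S p q \<longrightarrow> (\<exists>p'. D q p' \<and> duplicator_wins S D alive r p'))"
    unfolding duplicator_wins_iff_winning_strategy
    using winning_strategy_imp_alive[OF \<sigma>] winning_strategy_SucD[OF \<sigma>] by blast
next
  assume responses:
    "alive p \<and> (\<forall>q. S p q \<longrightarrow> (\<exists>p'. D q p' \<and> duplicator_wins S D alive r p'))"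
  then obtain g \<rho> where reply:
    "D q (g q)" "winning_strategy S D alive r (g q) (\<rho> q)" if "S p q" for q
    unfolding duplicator_wins_iff_winning_strategy by metis
  define \<sigma> where "\<sigma> qs = (if tl qs = [] then g (hd qs) else \<rho> (hd qs) (tl qs))" for qs
  have "winning_strategy S D alive (Suc r) p \<sigma>"
  proof (intro winning_strategy_SucI conjI)
    show "winning_strategy S D alive r (\<sigma> [q]) (\<lambda>qs. \<sigma> (q # qs))" if "S p q" for q
      using reply(2)[OF that] winning_strategy_cong[of "\<lambda>qs. \<sigma> (q # qs)" "\<rho> q"]
      by (simp add: \<sigma>_def)
  qed (use responses reply in \<open>simp_all add: \<sigma>_def\<close>)
  then show "duplicator_wins S D alive (Suc r) p"
    unfolding duplicator_wins_iff_winning_strategy by blast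
qed

lemma duplicator_wins_imp_alive:
  assumes "duplicator_wins S D alive r p"
  shows "alive p"
  using assms unfolding duplicator_wins_iff_winning_strategy
  by (elim exE winning_strategy_imp_alive)

lemma duplicator_wins_simulation:
  assumes alive: "\<And>s p p'. \<lbrakk>R s p p'; alive p\<rbrakk> \<Longrightarrow> alive' p'"
    and round: "\<And>s p p' q'. \<lbrakk>R (Suc s) p p'; S' p' q'\<rbrakk> \<Longrightarrow>
      \<exists>q. S p q \<and> (\<forall>p1. D q p1 \<longrightarrow> (\<exists>p1'. D' q' p1' \<and> R s p1 p1'))"
    and "R r p p'" "duplicator_wins S D alive r p"
  shows "duplicator_wins S' D' alive' r p'"
  using assms(3,4)
proof (induction r arbitrary: p p')
  case 0
  then show ?case
    by (auto simp: duplicator_wins_0 intro: alive)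
next
  case (Suc r)
  have "\<exists>p1'. D' q' p1' \<and> duplicator_wins S' D' alive' r p1'" if move: "S' p' q'" for q'
  proof -
    obtain q where q: "S p q" "\<And>p1. D q p1 \<Longrightarrow> \<exists>p1'. D' q' p1' \<and> R r p1 p1'"
      using round[OF Suc.prems(1) move] by blast
    then obtain p1 where "D q p1" "duplicator_wins S D alive r p1"
      using Suc.prems(2) unfolding duplicator_wins_Suc by blast
    with q(2) Suc.IH show ?thesis
      by blast
  qed
  then show ?case
    using alive Suc.prems duplicator_wins_imp_alive unfolding duplicator_wins_Suc by blast
qed

text \<open>In each round exactly one component is moved by Spoiler and the other by Duplicator, so it
  suffices to simulate the moves of either player on a single component; \<open>E s\<close> relates
  corresponding components when \<open>s\<close> rounds are left.\<close>

lemma duplicator_wins_componentwise_simulation: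
  assumes spoiler: "\<And>s X M M'. \<lbrakk>E (Suc s) X M; mS' M M'\<rbrakk> \<Longrightarrow> \<exists>X'. mS X X' \<and> E s X' M'"
    and duplicator: "\<And>s X M X'. \<lbrakk>E (Suc s) X M; mD X X'\<rbrakk> \<Longrightarrow> \<exists>M'. mD' M M' \<and> E s X' M'"
    and alive: "\<And>s X Y M N. \<lbrakk>E s X M; E s Y N; alive (X, Y)\<rbrakk> \<Longrightarrow> alive' (M, N)"
    and initial: "E r X M" "E r Y N"
    and wins: "duplicator_wins (spoiler_step mS) (duplicator_step mD) alive r (X, Y)"
  shows "duplicator_wins (spoiler_step mS') (duplicator_step mD') alive' r (M, N)"
proof (rule duplicator_wins_simulation[OF _ _ _ wins])
  let ?R = "\<lambda>s p p'. E s (fst p) (fst p') \<and> E s (snd p) (snd p')"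
  show "?R r (X, Y) (M, N)"
    using initial by simp
  show "alive' p'" if "?R s p p'" "alive p" for s p p'
    using alive[of s "fst p" "fst p'" "snd p" "snd p'"] that by simp
  show "\<exists>q. spoiler_step mS p q \<and>
      (\<forall>p1. duplicator_step mD q p1 \<longrightarrow> (\<exists>p1'. duplicator_step mD' q' p1' \<and> ?R s p1 p1'))"
    if related: "?R (Suc s) p p'" and move: "spoiler_step mS' p' q'" for s p p' q'
    using move
  proof (cases mS' p' q' rule: spoiler_step.elims(2))
    case (1 M N M' N')
    with related spoiler obtain X' where "mS (fst p) X'" "E s X' M'"
      by fastforce
    then show ?thesis
      using 1 related duplicator
      by (intro exI[of _ "(Left, X', snd p)"]) (cases p, fastforce)
  next
    case (2 M N M' N')
    with related spoiler obtain Y' where "mS (snd p) Y'" "E s Y' N'"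
      by fastforce
    then show ?thesis
      using 2 related duplicator
      by (intro exI[of _ "(Right, fst p, Y')"]) (cases p, fastforce)
  qed
qed

section \<open>Large fibres\<close>

lemma large_fibre_exists:
  assumes "finite K" "finite U" "U \<noteq> {}" "f ` K \<subseteq> U" "card U * n \<le> card K"
  shows "\<exists>a\<in>U. n \<le> card {k \<in> K. f k = a}"
proof (rule ccontr)
  assume small: "\<not> (\<exists>a\<in>U. n \<le> card {k \<in> K. f k = a})"
  have "card K = (\<Sum>a\<in>U. card {k \<in> K. f k = a})"
    using sum.group[OF assms(1,2,4), of "\<lambda>_. 1::nat"] by simp
  also have "\<dots> < (\<Sum>a\<in>U. n)"
    using small assms by (intro sum_strict_mono) auto
  finally show False
    using assms(5) by simp
qed

lemma even_distribution_exists: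
  assumes "finite K" "finite U" "U \<noteq> {}" "card U * n \<le> card K"
  shows "\<exists>g. (\<forall>k. g k \<in> U) \<and> (\<forall>a\<in>U. n \<le> card {k \<in> K. g k = a})"
proof -
  obtain u where u: "u \<in> U"
    using assms(3) by blast
  obtain e where e: "e ` (U \<times> {..<n}) \<subseteq> K" "inj_on e (U \<times> {..<n})"
    using card_le_inj[of "U \<times> {..<n}" K] assms by (auto simp: card_cartesian_product)
  define g where
    "g k = (if k \<in> e ` (U \<times> {..<n}) then fst (inv_into (U \<times> {..<n}) e k) else u)" for k
  have "g k \<in> U" for k
    using u inv_into_into[of k e "U \<times> {..<n}"] by (auto simp: g_def mem_Times_iff)
  moreover have "n \<le> card {k \<in> K. g k = a}" if "a \<in> U" for a
  proof -
    have "g (e (a, i)) = a" if "i < n" for i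
      using e(2) \<open>a \<in> U\<close> that by (simp add: g_def)
    then have "e ` ({a} \<times> {..<n}) \<subseteq> {k \<in> K. g k = a}"
      using e(1) \<open>a \<in> U\<close> by auto
    moreover have "inj_on e ({a} \<times> {..<n})"
      using e(2) by (rule inj_on_subset) (use \<open>a \<in> U\<close> in auto)
    ultimately show ?thesis
      using card_inj_on_le[of e "{a} \<times> {..<n}" "{k \<in> K. g k = a}"] assms(1)
      by (simp add: card_cartesian_product)
  qed
  ultimately show ?thesis
    by blast
qed

section \<open>Placing pebbles on sets and multisets of pebbled structures\<close>

lemma fst_place [simp]: "fst (place a p) = fst p"
  by (simp add: place_def)

lemma place_eq_iff [simp]: "place a p = place b q \<longleftrightarrow> a = b \<and> p = q"
  by (auto simp: place_def prod_eq_iff)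

definition nonempty_universes :: "('r, 'c, 'a) pebbled set \<Rightarrow> bool" where
  "nonempty_universes X \<longleftrightarrow> (\<forall>p\<in>X. univ (fst p) \<noteq> {})"

definition place_on_copies ::
  "(('r, 'c, 'a) pebbled \<Rightarrow> nat \<Rightarrow> 'a) \<Rightarrow> (('r, 'c, 'a) pebbled \<times> nat) set \<Rightarrow>
     (('r, 'c, 'a) pebbled \<times> nat) set" where
  "place_on_copies g M = (\<lambda>(p, k). (place (g p k) p, k)) ` M"

lemma place_each_copy_iff:
  "place_each_copy M M' \<longleftrightarrow>
     (\<exists>g. (\<forall>p k. (p, k) \<in> M \<longrightarrow> g p k \<in> univ (fst p)) \<and> M' = place_on_copies g M)"
proof
  assume "place_each_copy M M'"
  then obtain f where "\<forall>(p, k)\<in>M. f (p, k) \<in> univ (fst p)"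
    "M' = (\<lambda>(p, k). (place (f (p, k)) p, k)) ` M"
    unfolding place_each_copy_def by blast
  then show "\<exists>g. (\<forall>p k. (p, k) \<in> M \<longrightarrow> g p k \<in> univ (fst p)) \<and> M' = place_on_copies g M"
    unfolding place_on_copies_def by (intro exI[of _ "curry f"]) auto
next
  assume "\<exists>g. (\<forall>p k. (p, k) \<in> M \<longrightarrow> g p k \<in> univ (fst p)) \<and> M' = place_on_copies g M"
  then obtain g where "\<forall>p k. (p, k) \<in> M \<longrightarrow> g p k \<in> univ (fst p)" "M' = place_on_copies g M"
    by blast
  then show "place_each_copy M M'"
    unfolding place_each_copy_def place_on_copies_def
    by (intro exI[of _ "case_prod g"]) auto
qed

lemma place_on_copies_fibre:
  "place_on_copies g M `` {place a p} = {k \<in> M `` {p}. g p k = a}"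
  by (force simp: place_on_copies_def)

lemma place_each_nonempty_universes:
  assumes "place_each X X'" "nonempty_universes X"
  shows "nonempty_universes X'"
  using assms by (auto simp: nonempty_universes_def place_each_def)

lemma copy_and_place_nonempty_universes:
  assumes "copy_and_place X X'" "nonempty_universes X"
  shows "nonempty_universes X'"
  using assms by (auto simp: nonempty_universes_def copy_and_place_def place_def)

lemma place_each_copy_nonempty_universes:
  assumes "place_each_copy M M'" "nonempty_universes (fst ` M)"
  shows "nonempty_universes (fst ` M')"
  using assms by (force simp: nonempty_universes_def place_each_copy_def)

section \<open>Simulating the game without duplicating in the MS game\<close>

definition covers ::
  "('r, 'c, 'a) pebbled set \<Rightarrow> (('r, 'c, 'a) pebbled \<times> nat) set \<Rightarrow> bool" where
  "covers X M \<longleftrightarrow> fst ` M \<subseteq> X \<and> nonempty_universes X"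

lemma covers_place_each:
  assumes "covers X M" "place_each X X'"
  shows "\<exists>M'. place_each_copy M M' \<and> covers X' M'"
proof -
  have subset: "fst ` M \<subseteq> X" and nonempty: "nonempty_universes X'"
    using assms place_each_nonempty_universes by (auto simp: covers_def)
  obtain f where f: "\<forall>p\<in>X. f p \<in> univ (fst p)" "X' = (\<lambda>p. place (f p) p) ` X"
    using assms(2) unfolding place_each_def by blast
  have "place_each_copy M (place_on_copies (\<lambda>p _. f p) M)"
    unfolding place_each_copy_iff using f(1) subset by force
  moreover have "covers X' (place_on_copies (\<lambda>p _. f p) M)"
    using f(2) subset nonempty by (force simp: covers_def place_on_copies_def)
  ultimately show ?thesis
    by blast
qed

lemma covers_place_each_copy:
  assumes "covers X M" "place_each_copy M M'"
  shows "\<exists>X'. copy_and_place X X' \<and> covers X' M'"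
proof -
  have subset: "fst ` M \<subseteq> X" and nonempty: "nonempty_universes X"
    using assms(1) by (auto simp: covers_def)
  let ?X' = "{place a p | p a. p \<in> X \<and> a \<in> univ (fst p)}"
  have everywhere: "copy_and_place X ?X'"
    unfolding copy_and_place_def using nonempty
    by (intro exI[of _ "\<lambda>p. univ (fst p)"]) (auto simp: nonempty_universes_def)
  have "fst ` M' \<subseteq> ?X'"
    using subset assms(2) unfolding place_each_copy_def by fastforce
  then show ?thesis
    using everywhere copy_and_place_nonempty_universes[OF everywhere nonempty]
    unfolding covers_def by blast
qed

section \<open>Simulating the MS game in the game without duplicating\<close>

definition sufficient_copies ::
  "nat \<Rightarrow> ('r, 'c, 'a) pebbled set \<Rightarrow> (('r, 'c, 'a) pebbled \<times> nat) set \<Rightarrow> bool" where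
  "sufficient_copies s X M \<longleftrightarrow> nonempty_universes (fst ` M) \<and>
     (\<forall>p\<in>X. 0 < card (univ (fst p)) \<and> card (univ (fst p)) ^ s \<le> card (M `` {p}))"

lemma sufficient_copiesD:
  assumes "sufficient_copies s X M" "p \<in> X"
  shows "finite (univ (fst p))" "univ (fst p) \<noteq> {}" "finite (M `` {p})" "M `` {p} \<noteq> {}"
    "card (univ (fst p)) ^ s \<le> card (M `` {p})"
proof -
  have pos: "0 < card (univ (fst p))" and le: "card (univ (fst p)) ^ s \<le> card (M `` {p})"
    using assms by (auto simp: sufficient_copies_def)
  then have "0 < card (M `` {p})"
    using less_le_trans[OF zero_less_power] by blast
  with pos le show "finite (univ (fst p))" "univ (fst p) \<noteq> {}" "finite (M `` {p})"
    "M `` {p} \<noteq> {}" "card (univ (fst p)) ^ s \<le> card (M `` {p})"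
    unfolding card_gt_0_iff by auto
qed

lemma sufficient_copies_subset:
  assumes "sufficient_copies s X M"
  shows "X \<subseteq> fst ` M"
  using sufficient_copiesD(4)[OF assms] by force

lemma sufficient_copies_place_each_copy:
  assumes sufficient: "sufficient_copies (Suc s) X M" and move: "place_each_copy M M'"
  shows "\<exists>X'. place_each X X' \<and> sufficient_copies s X' M'"
proof -
  obtain g where g: "\<forall>p k. (p, k) \<in> M \<longrightarrow> g p k \<in> univ (fst p)"
    and M': "M' = place_on_copies g M"
    using move unfolding place_each_copy_iff by blast
  have "\<forall>p\<in>X. \<exists>a. a \<in> univ (fst p) \<and>
      card (univ (fst p)) ^ s \<le> card {k \<in> M `` {p}. g p k = a}"
  proof
    fix p assume "p \<in> X"
    note large = sufficient_copiesD[OF sufficient this]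
    have "g p ` (M `` {p}) \<subseteq> univ (fst p)"
      using g by blast
    from large_fibre_exists[OF large(3,1,2) this large(5)[unfolded power_Suc]]
    show "\<exists>a. a \<in> univ (fst p) \<and> card (univ (fst p)) ^ s \<le> card {k \<in> M `` {p}. g p k = a}"
      by blast
  qed
  from bchoice[OF this] obtain f where f: "\<forall>p\<in>X. f p \<in> univ (fst p)"
      "\<forall>p\<in>X. card (univ (fst p)) ^ s \<le> card {k \<in> M `` {p}. g p k = f p}"
    by blast
  have "place_each X ((\<lambda>p. place (f p) p) ` X)"
    unfolding place_each_def using f(1) by blast
  moreover have "sufficient_copies s ((\<lambda>p. place (f p) p) ` X) M'"
    using sufficient f(2) place_each_copy_nonempty_universes[OF move]
    by (simp add: sufficient_copies_def M' place_on_copies_fibre)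
  ultimately show ?thesis
    by blast
qed

lemma sufficient_copies_copy_and_place:
  assumes sufficient: "sufficient_copies (Suc s) X M" and "copy_and_place X X'"
  shows "\<exists>M'. place_each_copy M M' \<and> sufficient_copies s X' M'"
proof -
  have nonempty: "nonempty_universes (fst ` M)"
    using sufficient by (simp add: sufficient_copies_def)
  have "\<forall>p\<in>X. \<exists>h. (\<forall>k. h k \<in> univ (fst p)) \<and>
      (\<forall>a\<in>univ (fst p). card (univ (fst p)) ^ s \<le> card {k \<in> M `` {p}. h k = a})"
    using sufficient_copiesD[OF sufficient] by (intro ballI even_distribution_exists) auto
  from bchoice[OF this] obtain spread where spread: "\<forall>p\<in>X. \<forall>k. spread p k \<in> univ (fst p)"
      "\<forall>p\<in>X. \<forall>a\<in>univ (fst p).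
        card (univ (fst p)) ^ s \<le> card {k \<in> M `` {p}. spread p k = a}"
    by blast
  obtain fallback where fallback: "\<forall>p\<in>fst ` M. fallback p \<in> univ (fst p)"
    using bchoice[of "fst ` M" "\<lambda>p a. a \<in> univ (fst p)"] nonempty
    unfolding nonempty_universes_def by blast
  define g where "g p k = (if p \<in> X then spread p k else fallback p)" for p k
  have "g p k \<in> univ (fst p)" if "(p, k) \<in> M" for p k
    using spread(1) fallback that by (force simp: g_def)
  then have move: "place_each_copy M (place_on_copies g M)"
    unfolding place_each_copy_iff by blast
  have "0 < card (univ (fst q)) \<and>
      card (univ (fst q)) ^ s \<le> card (place_on_copies g M `` {q})" if "q \<in> X'" for q
  proof -
    obtain p a where "q = place a p" "p \<in> X" "a \<in> univ (fst p)"
      using assms(2) \<open>q \<in> X'\<close> unfolding copy_and_place_def by blast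
    then show ?thesis
      using sufficient spread(2) by (simp add: sufficient_copies_def place_on_copies_fibre g_def)
  qed
  then have "sufficient_copies s X' (place_on_copies g M)"
    using place_each_copy_nonempty_universes[OF move nonempty] by (simp add: sufficient_copies_def)
  with move show ?thesis
    by blast
qed

section \<open>Comparing the two games\<close>

lemma matching_exists_mono:
  assumes "matching_exists \<tau> (X, Y)" "X \<subseteq> X'" "Y \<subseteq> Y'"
  shows "matching_exists \<tau> (X', Y')"
  using assms by (auto simp: matching_exists_def)

abbreviation unpebbled :: "('r, 'c, 'a) struct set \<Rightarrow> ('r, 'c, 'a) pebbled set" where
  "unpebbled \<A> \<equiv> (\<lambda>A. (A, [])) ` \<A>"

abbreviation unpebbled_copies ::
  "(('r, 'c, 'a) struct \<times> nat) set \<Rightarrow> (('r, 'c, 'a) pebbled \<times> nat) set" where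
  "unpebbled_copies M \<equiv> (\<lambda>(A, k). ((A, []), k)) ` M"

lemma covers_unpebbled:
  assumes "fst ` M \<subseteq> \<A>" "\<forall>A\<in>\<A>. univ A \<noteq> {}"
  shows "covers (unpebbled \<A>) (unpebbled_copies M)"
  using assms by (force simp: covers_def nonempty_universes_def)

lemma sufficient_copies_unpebbled:
  assumes "\<forall>A\<in>fst ` M. univ A \<noteq> {}"
    and "\<forall>A\<in>\<A>. 0 < card (univ A) \<and> card (univ A) ^ r \<le> card (M `` {A})"
  shows "sufficient_copies r (unpebbled \<A>) (unpebbled_copies M)"
proof -
  have "unpebbled_copies M `` {(A, [])} = M `` {A}" for A
    by force
  moreover have "nonempty_universes (fst ` unpebbled_copies M)"
    using assms(1) by (force simp: nonempty_universes_def)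
  ultimately show ?thesis
    using assms(2) by (simp add: sufficient_copies_def)
qed

lemma duplicator_wins_MS_imp_nodup:
  fixes \<A> \<B> :: "('r, 'c, 'a) struct set"
  assumes "sufficient_copies r (unpebbled \<A>) (unpebbled_copies M)"
    and "sufficient_copies r (unpebbled \<B>) (unpebbled_copies N)"
    and "duplicator_wins_MS \<tau> r \<A> \<B>"
  shows "duplicator_wins_nodup \<tau> r M N"
  unfolding duplicator_wins_nodup_def
proof (rule duplicator_wins_componentwise_simulation[where E = sufficient_copies])
  show "(\<lambda>(X, Y). matching_exists \<tau> (fst ` X, fst ` Y)) (M, N)"
    if "sufficient_copies s X M" "sufficient_copies s Y N" "matching_exists \<tau> (X, Y)"
    for s X Y and M N :: "(('r, 'c, 'a) pebbled \<times> nat) set"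
    using that by (auto intro: matching_exists_mono dest: sufficient_copies_subset)
qed (fact sufficient_copies_place_each_copy sufficient_copies_copy_and_place assms(1,2)
    assms(3)[unfolded duplicator_wins_MS_def])+

lemma duplicator_wins_nodup_imp_MS:
  fixes \<A> \<B> :: "('r, 'c, 'a) struct set"
  assumes "covers (unpebbled \<A>) (unpebbled_copies M)" "covers (unpebbled \<B>) (unpebbled_copies N)"
    and "duplicator_wins_nodup \<tau> r M N"
  shows "duplicator_wins_MS \<tau> r \<A> \<B>"
  unfolding duplicator_wins_MS_def
proof (rule duplicator_wins_componentwise_simulation[where E = "\<lambda>_ M X. covers X M"])
  show "matching_exists \<tau> (X, Y)"
    if "covers X M" "covers Y N" "(\<lambda>(X, Y). matching_exists \<tau> (fst ` X, fst ` Y)) (M, N)"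
    for X Y and M N :: "(('r, 'c, 'a) pebbled \<times> nat) set"
    using that by (auto simp: covers_def intro: matching_exists_mono)
qed (fact covers_place_each covers_place_each_copy assms(1,2)
    assms(3)[unfolded duplicator_wins_nodup_def])+

lemma copies_fibre:
  assumes "A \<in> \<A>"
  shows "copies r \<A> `` {A} = {..<card (univ A) ^ r}"
  using assms by (auto simp: copies_def)

lemma fst_copies_subset: "fst ` copies r \<A> \<subseteq> \<A>"
  by (auto simp: copies_def)

lemma finite_structure_card_pos:
  assumes "finite_structure \<tau> A"
  shows "0 < card (univ A)"
  using assms by (simp add: finite_structure_def is_structure_def card_gt_0_iff)

lemma covers_copies:
  assumes "\<forall>A\<in>\<A>. finite_structure \<tau> A"
  shows "covers (unpebbled \<A>) (unpebbled_copies (copies r \<A>))"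
  using covers_unpebbled[OF fst_copies_subset] finite_structure_card_pos assms by fastforce

lemma sufficient_copies_copies:
  assumes "\<forall>A\<in>\<A>. finite_structure \<tau> A"
  shows "sufficient_copies r (unpebbled \<A>) (unpebbled_copies (copies r \<A>))"
proof (intro sufficient_copies_unpebbled ballI conjI)
  show "0 < card (univ A)" if "A \<in> \<A>" for A
    using finite_structure_card_pos assms that by blast
  then show "univ A \<noteq> {}" if "A \<in> fst ` copies r \<A>" for A
    using fst_copies_subset that by fastforce
qed (simp add: copies_fibre)

theorem theorem3p5:
  fixes \<tau> :: "('r, 'c) schema" and r :: nat
    and \<A> \<B> :: "('r, 'c, 'a) struct set"
  assumes "finite_schema \<tau>"
    and "\<forall>A\<in>\<A>. finite_structure \<tau> A"
    and "\<forall>B\<in>\<B>. finite_structure \<tau> B"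
  shows "duplicator_wins_MS \<tau> r \<A> \<B> \<longleftrightarrow>
         duplicator_wins_nodup \<tau> r (copies r \<A>) (copies r \<B>)"
proof
  assume "duplicator_wins_MS \<tau> r \<A> \<B>"
  with sufficient_copies_copies[OF assms(2)] sufficient_copies_copies[OF assms(3)]
  show "duplicator_wins_nodup \<tau> r (copies r \<A>) (copies r \<B>)"
    by (rule duplicator_wins_MS_imp_nodup)
next
  assume "duplicator_wins_nodup \<tau> r (copies r \<A>) (copies r \<B>)"
  with covers_copies[OF assms(2)] covers_copies[OF assms(3)]
  show "duplicator_wins_MS \<tau> r \<A> \<B>"
    by (rule duplicator_wins_nodup_imp_MS)
qed

end
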